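(* Let $L,N$ be positive integers with $L+1<N$. Let $\mathbf{G}\in\mathbb{C}^{L\times N}$ be a random matrix with independent $\mathcal{CN}(0,\sigma_1^2)$ entries, let $\mathbf{x}\sim\mathcal{CN}(0,\sigma_2^2\mathbf{I}_L)$ be independent of $\mathbf{G}$, and let $\rho=\sigma_2/\sigma_1$. Then $$\mathbb{E}\big(\|\mathbf{G}^{+}\mathbf{x}\|\big)\ \le\ \sqrt{\frac{L}{N-L-1}}\,\rho,$$ where $\mathbf{G}^{+}=\mathbf{G}^H(\mathbf{G}\mathbf{G}^H)^{-1}$ is the Moore–Penrose pseudo-inverse.
   Context: $\|\cdot\|$ denotes the Euclidean norm. $\mathcal{CN}$ denotes the circularly symmetric complex Gaussian distribution; $(\cdot)^H$ is the conjugate transpose. *)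

theory Defs
  imports "HOL-Analysis.Analysis"
begin

text \<open>Density (w.r.t. Lebesgue measure on the complex plane) of the circularly
  symmetric complex Gaussian CN(0, v) with variance v > 0.\<close>
definition cgauss_density :: "real \<Rightarrow> complex \<Rightarrow> real" where
  "cgauss_density v z = exp (- (cmod z)\<^sup>2 / v) / (pi * v)"

definition cgauss_matrix :: "real \<Rightarrow> (complex ^ 'n ^ 'm) measure" where
  "cgauss_matrix v = density lborel
     (\<lambda>A. ennreal (\<Prod>i\<in>UNIV. \<Prod>j\<in>UNIV. cgauss_density v (A $ i $ j)))"

definition cgauss_vector :: "real \<Rightarrow> (complex ^ 'm) measure" where
  "cgauss_vector v = density lborel
     (\<lambda>x. ennreal (\<Prod>i\<in>UNIV. cgauss_density v (x $ i)))"

definition conj_transpose :: "complex ^ 'n ^ 'm \<Rightarrow> complex ^ 'm ^ 'n" where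
  "conj_transpose A = (\<chi> j i. cnj (A $ i $ j))"

text \<open>Pseudo-inverse of a (full row rank) matrix: G^H (G G^H)^{-1}.\<close>
definition pinv :: "complex ^ 'n ^ 'm \<Rightarrow> complex ^ 'm ^ 'n" where
  "pinv G = conj_transpose G ** matrix_inv (G ** conj_transpose G)"

end

theory Submission
  imports Defs "HOL-Probability.Distributions"
begin

text \<open>
  For fixed \<open>G\<close>, the mean of \<open>\<parallel>G\<^sup>+ x\<parallel>\<^sup>2\<close> is \<open>\<sigma>\<^sub>2\<^sup>2\<close> times the sum of the squared norms of the columns
  of \<open>G\<^sup>+\<close>, and the norm of the \<open>i\<close>-th column is at most \<open>1 / d\<close>, where \<open>d\<close> is the distance
  of the \<open>i\<close>-th row of \<open>G\<close> to the span \<open>V\<close> of the other rows. Conditionally on the other rows, the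
  \<open>i\<close>-th row is Gaussian and \<open>V\<close> has real dimension at most \<open>2 (L - 1)\<close>, so rotating \<open>V\<close> into a
  coordinate subspace bounds the mean of \<open>exp (- s d\<^sup>2)\<close> by \<open>(1 + s \<sigma>\<^sub>1\<^sup>2)\<close> to the power
  \<open>- (N - L + 1)\<close>. Integrating over \<open>s \<ge> 0\<close> bounds the mean of \<open>1 / d\<^sup>2\<close> by \<open>1 / (\<sigma>\<^sub>1\<^sup>2 (N - L))\<close>.
\<close>

section \<open>Gaussian integrals on Euclidean spaces\<close>

lemma nn_integral_lborel_translate:
  fixes h :: "'a::euclidean_space \<Rightarrow> ennreal"
  assumes [measurable]: "h \<in> borel_measurable borel"
  shows "(\<integral>\<^sup>+x. h (x + t) \<partial>lborel) = (\<integral>\<^sup>+x. h x \<partial>lborel)"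
proof -
  have "(\<integral>\<^sup>+x. h x \<partial>lborel) = (\<integral>\<^sup>+x. h x \<partial>distr lborel borel ((+) t))"
    by (simp add: lborel_distr_plus)
  also have "\<dots> = (\<integral>\<^sup>+x. h (x + t) \<partial>lborel)"
    by (subst nn_integral_distr) (simp_all add: add.commute)
  finally show ?thesis by simp
qed

text \<open>Fubini applied to \<open>h (f x + y) \<psi> y\<close> with \<open>\<psi>\<close> the indicator of the unit ball, which \<open>f\<close> preserves,
  avoids determinants.\<close>
lemma nn_integral_lborel_orthogonal:
  fixes h :: "'a::euclidean_space \<Rightarrow> ennreal" and f :: "'a \<Rightarrow> 'a"
  assumes [measurable]: "h \<in> borel_measurable borel" and f: "orthogonal_transformation f"
  shows "(\<integral>\<^sup>+x. h (f x) \<partial>lborel) = (\<integral>\<^sup>+x. h x \<partial>lborel)"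
proof -
  define \<psi> :: "'a \<Rightarrow> ennreal" where "\<psi> = indicator (ball 0 1)"
  define K where "K = (\<integral>\<^sup>+x. \<psi> x \<partial>lborel)"
  obtain g where g: "orthogonal_transformation g" and fg: "\<And>x. f (g x) = x"
    using orthogonal_transformation_inv[OF f] orthogonal_transformation_surj[OF f]
    by (metis surj_f_inv_f)
  have [measurable]: "f \<in> borel_measurable borel"
    using f by (intro borel_measurable_continuous_onI linear_continuous_on)
      (simp add: linear_conv_bounded_linear[symmetric] orthogonal_transformation_linear)
  have [measurable]: "\<psi> \<in> borel_measurable borel" unfolding \<psi>_def by (rule borel_measurable_indicator) simp
  have K: "K \<noteq> 0" "K \<noteq> \<infinity>"
    using content_ball_pos[of 1 "0::'a"] emeasure_lborel_ball_finite[of "0::'a" 1]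
    by (auto simp: K_def \<psi>_def emeasure_eq_ennreal_measure)
  \<comment> \<open>As \<open>f\<close> preserves norms, \<open>y\<close> lies in the unit ball
    around \<open>f x\<close> exactly when \<open>x\<close> lies in the one around
    \<open>g y\<close>.\<close>
  have sym: "\<psi> (y - f x) = \<psi> (x + (- g y))" for x y
  proof -
    have "norm (y - f x) = norm (f (g y - x))"
      by (simp add: linear_diff[OF orthogonal_transformation_linear[OF f]] fg)
    also have "\<dots> = norm (x + (- g y))"
      by (simp add: orthogonal_transformation_norm[OF f] norm_minus_commute)
    finally show ?thesis by (simp add: \<psi>_def indicator_def)
  qed
  have "(\<integral>\<^sup>+x. h (f x) \<partial>lborel) * K = (\<integral>\<^sup>+y. (\<integral>\<^sup>+x. h (f x) * \<psi> y \<partial>lborel) \<partial>lborel)"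
    by (simp add: nn_integral_multc nn_integral_cmult K_def)
  \<comment> \<open>For fixed \<open>y\<close>, shift \<open>x\<close> by \<open>g y\<close>: since
    \<open>f (x + g y) = f x + y\<close>, the rotation turns into a translation in the variable
    \<open>y\<close>.\<close>
  also have "\<dots> = (\<integral>\<^sup>+y. (\<integral>\<^sup>+x. h (f (x + g y)) * \<psi> y \<partial>lborel) \<partial>lborel)"
    by (intro nn_integral_cong nn_integral_lborel_translate[symmetric]) measurable
  also have "\<dots> = (\<integral>\<^sup>+y. (\<integral>\<^sup>+x. h (f x + y) * \<psi> y \<partial>lborel) \<partial>lborel)"
    by (simp add: linear_add[OF orthogonal_transformation_linear[OF f]] fg)
  also have "\<dots> = (\<integral>\<^sup>+x. (\<integral>\<^sup>+y. h (f x + y) * \<psi> y \<partial>lborel) \<partial>lborel)"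
    by (rule lborel_pair.Fubini') measurable
  also have "\<dots> = (\<integral>\<^sup>+x. (\<integral>\<^sup>+y. h y * \<psi> (y - f x) \<partial>lborel) \<partial>lborel)"
  proof (rule nn_integral_cong)
    fix x
    show "(\<integral>\<^sup>+y. h (f x + y) * \<psi> y \<partial>lborel) = (\<integral>\<^sup>+y. h y * \<psi> (y - f x) \<partial>lborel)"
      using nn_integral_lborel_translate[of "\<lambda>y. h y * \<psi> (y - f x)" "f x"]
      by (simp add: add.commute)
  qed
  also have "\<dots> = (\<integral>\<^sup>+y. (\<integral>\<^sup>+x. h y * \<psi> (y - f x) \<partial>lborel) \<partial>lborel)"
    by (rule lborel_pair.Fubini') measurable
  also have "\<dots> = (\<integral>\<^sup>+y. h y * K \<partial>lborel)"
    by (simp add: sym nn_integral_cmult nn_integral_lborel_translate K_def del: add_uminus_conv_diff)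
  also have "\<dots> = (\<integral>\<^sup>+x. h x \<partial>lborel) * K"
    by (simp add: nn_integral_multc)
  finally show ?thesis
    using K by (simp add: mult.commute[of _ K] ennreal_mult_cancel_left)
qed

text \<open>Complete \<open>S\<close> by an orthonormal basis \<open>B\<close> of its orthogonal
  complement. Counting dimensions, \<open>S \<union> B\<close> has as many elements as
  \<open>Basis\<close>; the linear extension of a bijection between the two preserves inner
  products.\<close>

lemma orthonormal_subset_orthogonal_image_Basis:
  fixes S :: "'a::euclidean_space set"
  assumes S: "pairwise orthogonal S" "\<And>x. x \<in> S \<Longrightarrow> norm x = 1"
  obtains f :: "'a \<Rightarrow> 'a" where "orthogonal_transformation f" "S \<subseteq> f ` Basis"
proof -
  define W where "W = {y. \<forall>x\<in>span S. orthogonal x y}"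
  have W: "subspace W" unfolding W_def by (rule subspace_orthogonal_to_vectors)
  obtain B where B: "B \<subseteq> W" "pairwise orthogonal B" "\<And>x. x \<in> B \<Longrightarrow> norm x = 1"
      "independent B" "card B = dim W"
    using orthonormal_basis_subspace[OF W] by metis
  have fB: "finite B" using B(4) by (rule independent_imp_finite)
  have indS: "independent S"
    using S by (intro pairwise_orthogonal_independent) (auto dest: S(2))
  have fS: "finite S" using indS by (rule independent_imp_finite)
  have cross: "orthogonal x y" if "x \<in> S" "y \<in> B" for x y
    using that B(1) by (auto simp: W_def span_base)
  have disj: "S \<inter> B = {}"
    using cross B(3) by (force simp: orthogonal_def dot_square_norm)
  have "dim W + dim (span S) = DIM('a)"
    using dim_subspace_orthogonal_to_vectors[of "span S" UNIV] by (simp add: W_def)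
  then have card: "card (S \<union> B) = card (Basis :: 'a set)"
    using disj fB fS B(5) indS by (simp add: card_Un_disjoint dim_eq_card_independent)
  then obtain \<beta> where \<beta>: "bij_betw \<beta> (Basis :: 'a set) (S \<union> B)"
    using finite_same_card_bij[of "Basis :: 'a set" "S \<union> B"] fB fS by auto
  define f where "f x = (\<Sum>b\<in>Basis. (x \<bullet> b) *\<^sub>R \<beta> b)" for x :: 'a
  have orth: "\<beta> a \<bullet> \<beta> b = (if a = b then 1 else 0)" if "a \<in> Basis" "b \<in> Basis" for a b
  proof (cases "a = b")
    case True
    have "\<beta> b \<in> S \<union> B" using \<beta> that by (auto simp: bij_betw_def)
    then show ?thesis using True S(2) B(3) by (auto simp: dot_square_norm)
  next
    case False
    then have "\<beta> a \<noteq> \<beta> b" "\<beta> a \<in> S \<union> B" "\<beta> b \<in> S \<union> B"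
      using \<beta> that by (auto simp: bij_betw_def inj_on_def)
    then show ?thesis
      using False S(1) B(2) cross[of "\<beta> a" "\<beta> b"] cross[of "\<beta> b" "\<beta> a"]
      by (auto simp: pairwise_def orthogonal_def inner_commute)
  qed
  have "f x \<bullet> f y = x \<bullet> y" for x y
  proof -
    have "f x \<bullet> f y = (\<Sum>a\<in>Basis. \<Sum>b\<in>Basis. (x \<bullet> a) * (y \<bullet> b) * (\<beta> a \<bullet> \<beta> b))"
      by (simp add: f_def inner_sum_left inner_sum_right sum_distrib_left mult_ac)
        (subst sum.swap, simp add: mult_ac)
    also have "\<dots> = (\<Sum>a\<in>Basis. (x \<bullet> a) * (y \<bullet> a))"
      by (simp add: orth if_distrib[of "\<lambda>t. _ * t"] cong: sum.cong if_cong)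
    also have "\<dots> = x \<bullet> y" by (rule euclidean_inner[symmetric])
    finally show ?thesis .
  qed
  moreover have "linear f"
    by (rule linearI) (simp_all add: f_def inner_add_left scaleR_add_left sum.distrib scaleR_sum_right)
  ultimately have "orthogonal_transformation f" by (simp add: orthogonal_transformation_def)
  moreover have "f b = \<beta> b" if "b \<in> Basis" for b
    using that by (simp add: f_def inner_Basis if_distrib[of "\<lambda>t. t *\<^sub>R _"] cong: if_cong)
  then have "S \<subseteq> f ` Basis"
    using \<beta> by (auto simp: bij_betw_def image_iff)
  ultimately show thesis by (rule that)
qed

section \<open>The isotropic Gaussian density and its moments\<close>

text \<open>Each real coordinate has variance \<open>v / 2\<close>, so on the complex plane this is
  the density of CN(0, v). Over a general Euclidean space it covers scalars, vectors and matrices at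
  once.\<close>

definition gauss_density :: "real \<Rightarrow> 'a::euclidean_space \<Rightarrow> real" where
  "gauss_density v x = exp (- (norm x)\<^sup>2 / v) / sqrt (pi * v) ^ DIM('a)"

lemma gauss_density_nonneg [simp]: "v > 0 \<Longrightarrow> gauss_density v x \<ge> 0"
  by (simp add: gauss_density_def)

lemma gauss_density_minus [simp]: "gauss_density v (- x) = gauss_density v x"
  by (simp add: gauss_density_def)

lemma gauss_density_measurable [measurable]: "gauss_density v \<in> borel_measurable borel"
  unfolding gauss_density_def by measurable

text \<open>Squared norms add over the components and dimensions multiply, so independent Gaussian
  components form one Gaussian on the larger space.\<close>

lemma gauss_density_vec:
  fixes x :: "'a::euclidean_space ^ 'm"
  shows "(\<Prod>i\<in>UNIV. gauss_density v (x $ i)) = gauss_density v x"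
proof -
  have "(norm x)\<^sup>2 = (\<Sum>i\<in>UNIV. (norm (x $ i))\<^sup>2)"
    by (simp add: norm_vec_def L2_set_def sum_nonneg)
  then show ?thesis
    by (simp add: gauss_density_def prod_dividef exp_sum sum_divide_distrib sum_negf[symmetric]
        power_mult[symmetric] mult.commute)
qed

lemma norm_power2_eq_sum_Basis:
  fixes x :: "'a::euclidean_space"
  shows "(norm x)\<^sup>2 = (\<Sum>b\<in>Basis. (x \<bullet> b)\<^sup>2)"
  unfolding power2_norm_eq_inner by (subst euclidean_inner) (simp add: power2_eq_square)

lemma gauss_density_Basis:
  fixes x :: "'a::euclidean_space"
  shows "gauss_density v x = (\<Prod>b\<in>Basis. gauss_density v (x \<bullet> b))"
proof -
  have "exp (- (norm x)\<^sup>2 / v) = (\<Prod>b\<in>Basis. exp (- (x \<bullet> b)\<^sup>2 / v))"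
    by (simp add: norm_power2_eq_sum_Basis[of x] exp_sum[symmetric] sum_negf sum_divide_distrib)
  then show ?thesis by (simp add: gauss_density_def prod_dividef)
qed

lemma nn_integral_gauss_density_real:
  fixes v s :: real
  assumes v: "v > 0" and s: "s \<ge> 0"
  shows "(\<integral>\<^sup>+x. ennreal (gauss_density v (x::real) * exp (- s * x\<^sup>2)) \<partial>lborel)
           = ennreal (1 / sqrt (1 + s * v))"
proof -
  \<comment> \<open>Chosen so that \<open>1 / w = 1 / v + s\<close>: the tilted density is again
    Gaussian up to the ratio of the normalising constants. \<open>normal_density\<close> takes a
    standard deviation, hence \<open>sqrt (w/2)\<close> below.\<close>
  define w where "w = v / (1 + s * v)"
  have p: "1 + s * v > 0" using v s by (simp add: add_pos_nonneg)
  have w: "w > 0" using v p by (simp add: w_def)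
  have eq: "gauss_density v x * exp (- s * x\<^sup>2) = 1 / sqrt (1 + s * v) * normal_density 0 (sqrt (w/2)) x" for x
  proof -
    have "sqrt (pi * v) = sqrt (1 + s * v) * sqrt (2 * pi * (sqrt (w / 2))\<^sup>2)"
      using w p by (simp add: real_sqrt_mult[symmetric]) (simp add: w_def)
    moreover have "exp (- x\<^sup>2 / v) * exp (- s * x\<^sup>2) = exp (- x\<^sup>2 / w)"
      using v p by (simp add: exp_add[symmetric] w_def field_simps)
    ultimately show ?thesis
      using w by (simp add: gauss_density_def normal_density_def)
  qed
  have "(\<integral>\<^sup>+x. ennreal (normal_density 0 (sqrt (w/2)) x) \<partial>lborel) = 1"
    using w by (subst nn_integral_eq_integral) auto
  then show ?thesis
    unfolding eq using p by (subst ennreal_mult') (simp_all add: nn_integral_cmult)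
qed

lemma nn_integral_gauss_density_square_real:
  fixes v :: real
  assumes v: "v > 0"
  shows "(\<integral>\<^sup>+x. ennreal (gauss_density v (x::real) * x\<^sup>2) \<partial>lborel) = ennreal (v / 2)"
proof -
  have eq: "gauss_density v x = normal_density 0 (sqrt (v/2)) x" for x
    using v by (simp add: gauss_density_def normal_density_def)
  have *: "has_bochner_integral lborel (\<lambda>x. normal_density 0 (sqrt (v/2)) x * x\<^sup>2) (v / 2)"
    using normal_moment_even[of "sqrt (v/2)" 0 1] v by (simp add: fact_numeral)
  show ?thesis
    unfolding eq nn_integral_eq_integral[OF integrable.intros[OF *], simplified]
    by (simp only: has_bochner_integral_integral_eq[OF *])
qed

lemma nn_integral_gauss_density_coords:
  fixes C :: "'a::euclidean_space set"
  assumes v: "v > 0" and s: "s \<ge> 0" and C: "C \<subseteq> Basis"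
  shows "(\<integral>\<^sup>+x. ennreal (gauss_density v x * exp (- s * (\<Sum>b\<in>C. (x \<bullet> b)\<^sup>2))) \<partial>lborel)
           = ennreal ((1 / sqrt (1 + s * v)) ^ card C)"
proof -
  \<comment> \<open>Using the exponent 0 outside \<open>C\<close> writes the integrand as a product
    over all of \<open>Basis\<close>; the factors outside \<open>C\<close> integrate to 1.\<close>
  define h where "h b t = ennreal (gauss_density v t * exp (- (if b \<in> C then s else 0) * t\<^sup>2))"
    for b :: 'a and t :: real
  have [measurable]: "h b \<in> borel_measurable borel" for b unfolding h_def by measurable
  have "exp (- s * (\<Sum>b\<in>C. (x \<bullet> b)\<^sup>2)) = (\<Prod>b\<in>Basis. exp (- (if b \<in> C then s else 0) * (x \<bullet> b)\<^sup>2))" for x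
  proof -
    have "(\<Sum>b\<in>C. - s * (x \<bullet> b)\<^sup>2) = (\<Sum>b\<in>Basis. - (if b \<in> C then s else 0) * (x \<bullet> b)\<^sup>2)"
      using C by (intro sum.mono_neutral_cong_left) auto
    then show ?thesis by (simp add: exp_sum[symmetric] sum_distrib_left)
  qed
  then have "ennreal (gauss_density v x * exp (- s * (\<Sum>b\<in>C. (x \<bullet> b)\<^sup>2))) = (\<Prod>b\<in>Basis. h b (x \<bullet> b))" for x
    using v by (simp add: h_def prod_ennreal gauss_density_Basis[of v x] prod.distrib)
  then have "(\<integral>\<^sup>+x. ennreal (gauss_density v x * exp (- s * (\<Sum>b\<in>C. (x \<bullet> b)\<^sup>2))) \<partial>lborel)
      = (\<Prod>b\<in>Basis. \<integral>\<^sup>+t. h b t \<partial>lborel)"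
    by (simp add: nn_integral_lborel_prod)
  also have "\<dots> = (\<Prod>b\<in>Basis. ennreal (1 / sqrt (1 + (if b \<in> C then s else 0) * v)))"
    unfolding h_def using v s by (intro prod.cong refl nn_integral_gauss_density_real) auto
  also have "\<dots> = (\<Prod>b\<in>C. ennreal (1 / sqrt (1 + s * v)))"
    using C by (intro prod.mono_neutral_cong_right) auto
  also have "\<dots> = ennreal ((1 / sqrt (1 + s * v)) ^ card C)"
    using v s by (simp add: ennreal_power del: ennreal_1)
  finally show ?thesis .
qed

lemma nn_integral_gauss_density:
  "v > 0 \<Longrightarrow> (\<integral>\<^sup>+x. ennreal (gauss_density v (x::'a::euclidean_space)) \<partial>lborel) = 1"
  using nn_integral_gauss_density_coords[of v 0 "{} :: 'a set"] by simp

text \<open>By rotation invariance the unit vector along \<open>u\<close> may be taken to be a basis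
  vector \<open>c\<close>. The integral then factors over coordinates: a second moment at
  \<open>c\<close>, total mass 1 elsewhere.\<close>

lemma nn_integral_gauss_density_inner:
  fixes u :: "'a::euclidean_space"
  assumes v: "v > 0"
  shows "(\<integral>\<^sup>+x. ennreal (gauss_density v x * (x \<bullet> u)\<^sup>2) \<partial>lborel) = ennreal (v / 2 * (norm u)\<^sup>2)"
proof (cases "u = 0")
  case False
  define u' where "u' = u /\<^sub>R norm u"
  have u: "u = norm u *\<^sub>R u'" "norm u' = 1" using False by (auto simp: u'_def)
  obtain f where f: "orthogonal_transformation f" and "{u'} \<subseteq> f ` (Basis :: 'a set)"
    using orthonormal_subset_orthogonal_image_Basis[of "{u'}"] u(2) by (auto simp: pairwise_def)
  then obtain c where c: "c \<in> Basis" "u' = f c" by auto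
  define h where "h b t = ennreal (gauss_density v t * (if b = c then t\<^sup>2 else 1))"
    for b :: 'a and t :: real
  have [measurable]: "h b \<in> borel_measurable borel" for b unfolding h_def by measurable
  have inner: "f x \<bullet> u' = x \<bullet> c" for x
    using f by (simp add: c(2) orthogonal_transformation_def)
  have "(\<integral>\<^sup>+x. ennreal (gauss_density v x * (x \<bullet> u')\<^sup>2) \<partial>lborel)
      = (\<integral>\<^sup>+x. ennreal (gauss_density v (f x) * (f x \<bullet> u')\<^sup>2) \<partial>lborel)"
    by (rule nn_integral_lborel_orthogonal[OF _ f, symmetric]) measurable
  also have "\<dots> = (\<integral>\<^sup>+x. ennreal (gauss_density v x * (x \<bullet> c)\<^sup>2) \<partial>lborel)"
    by (simp add: inner gauss_density_def orthogonal_transformation_norm[OF f])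
  also have "\<dots> = (\<integral>\<^sup>+x. (\<Prod>b\<in>Basis. h b (x \<bullet> b)) \<partial>lborel)"
  proof (rule nn_integral_cong)
    fix x :: 'a
    show "ennreal (gauss_density v x * (x \<bullet> c)\<^sup>2) = (\<Prod>b\<in>Basis. h b (x \<bullet> b))"
      using v c(1) by (simp add: h_def prod_ennreal gauss_density_Basis[of v x] prod.distrib)
  qed
  also have "\<dots> = (\<Prod>b\<in>Basis. \<integral>\<^sup>+t. h b t \<partial>lborel)"
    by (simp add: nn_integral_lborel_prod)
  also have "\<dots> = (\<Prod>b\<in>Basis. if b = c then ennreal (v / 2) else 1)"
    unfolding h_def using v
    by (intro prod.cong refl)
      (simp add: nn_integral_gauss_density_square_real nn_integral_gauss_density)
  also have "\<dots> = ennreal (v / 2)" using c(1) by simp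
  finally have *: "(\<integral>\<^sup>+x. ennreal (gauss_density v x * (x \<bullet> u')\<^sup>2) \<partial>lborel) = ennreal (v / 2)" .
  have "(\<integral>\<^sup>+x. ennreal (gauss_density v x * (x \<bullet> u)\<^sup>2) \<partial>lborel)
      = (\<integral>\<^sup>+x. ennreal ((norm u)\<^sup>2) * ennreal (gauss_density v x * (x \<bullet> u')\<^sup>2) \<partial>lborel)"
    by (subst u(1)) (simp add: power_mult_distrib ennreal_mult'[symmetric] mult_ac)
  also have "\<dots> = ennreal (v / 2 * (norm u)\<^sup>2)"
    using v by (subst nn_integral_cmult) (simp_all add: * ennreal_mult'[symmetric] mult_ac)
  finally show ?thesis .
qed simp

text \<open>A rotation \<open>f\<close> carries a set \<open>C\<close> of coordinate directions onto
  an orthonormal basis of the orthogonal complement of \<open>V\<close>. The coordinates in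
  \<open>C\<close> bound the distance to \<open>V\<close> from below, and this suffices because
  \<open>exp (- s d\<^sup>2)\<close> decreases in \<open>d\<close>.\<close>

lemma nn_integral_gauss_density_infdist:
  fixes V :: "'a::euclidean_space set"
  assumes v: "v > 0" and s: "s \<ge> 0" and V: "subspace V"
  shows "(\<integral>\<^sup>+x. ennreal (gauss_density v x * exp (- s * (infdist x V)\<^sup>2)) \<partial>lborel)
           \<le> ennreal ((1 / sqrt (1 + s * v)) ^ (DIM('a) - dim V))"
proof -
  define W where "W = {y. \<forall>x\<in>V. orthogonal x y}"
  have W: "subspace W" unfolding W_def by (rule subspace_orthogonal_to_vectors)
  obtain B where B: "B \<subseteq> W" "pairwise orthogonal B" "\<And>x. x \<in> B \<Longrightarrow> norm x = 1"
      "independent B" "card B = dim W"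
    using orthonormal_basis_subspace[OF W] by metis
  have dimW: "card B = DIM('a) - dim V"
    using dim_subspace_orthogonal_to_vectors[OF V subspace_UNIV] B(5) by (simp add: W_def)
  obtain f where f: "orthogonal_transformation f" and fB': "B \<subseteq> f ` (Basis :: 'a set)"
    using orthonormal_subset_orthogonal_image_Basis[of B] B by auto
  define C where "C = Basis \<inter> f -` B"
  have inj: "inj_on f C" using orthogonal_transformation_inj[OF f] by (rule inj_on_subset) simp
  have fC: "f ` C = B" using fB' by (auto simp: C_def)
  have cC: "card C = DIM('a) - dim V" using card_image[OF inj] fC dimW by simp
  have le: "(\<Sum>b\<in>C. (x \<bullet> b)\<^sup>2) \<le> (infdist (f x) V)\<^sup>2" for x
  proof -
    have V0: "0 \<in> V" using V by (rule subspace_0)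
    have "sqrt (\<Sum>b\<in>C. (x \<bullet> b)\<^sup>2) \<le> dist (f x) z" if "z \<in> V" for z
    proof -
      obtain y where y: "f y = z" using orthogonal_transformation_surj[OF f] by (metis surjD)
      \<comment> \<open>The preimage \<open>y\<close> of a point of \<open>V\<close> has no
        component along \<open>C\<close>, so subtracting it from \<open>x\<close> leaves those
        coordinates unchanged.\<close>
      have y0: "y \<bullet> b = 0" if "b \<in> C" for b
      proof -
        have "f b \<in> W" using that fC B(1) by auto
        then have "f y \<bullet> f b = 0" using \<open>z \<in> V\<close> y by (auto simp: W_def orthogonal_def)
        then show ?thesis using f by (simp add: orthogonal_transformation_def)
      qed
      have "(\<Sum>b\<in>C. (x \<bullet> b)\<^sup>2) = (\<Sum>b\<in>C. ((x - y) \<bullet> b)\<^sup>2)"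
        by (intro sum.cong refl) (simp add: inner_diff_left y0)
      also have "\<dots> \<le> (\<Sum>b\<in>Basis. ((x - y) \<bullet> b)\<^sup>2)"
        by (intro sum_mono2) (auto simp: C_def)
      also have "\<dots> = (norm (x - y))\<^sup>2"
        by (rule norm_power2_eq_sum_Basis[symmetric])
      also have "norm (x - y) = dist (f x) z"
        using y by (simp add: dist_norm linear_diff[OF orthogonal_transformation_linear[OF f], symmetric]
          orthogonal_transformation_norm[OF f] flip: y)
      finally show ?thesis by (simp add: real_le_lsqrt)
    qed
    then have "sqrt (\<Sum>b\<in>C. (x \<bullet> b)\<^sup>2) \<le> infdist (f x) V"
      using V0 by (auto simp: infdist_def intro!: cINF_greatest)
    then show ?thesis by (simp add: sqrt_le_D)
  qed
  have [measurable]: "(\<lambda>x. infdist x V) \<in> borel_measurable borel"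
    by (intro borel_measurable_continuous_onI continuous_intros)
  have "(\<integral>\<^sup>+x. ennreal (gauss_density v x * exp (- s * (infdist x V)\<^sup>2)) \<partial>lborel)
      = (\<integral>\<^sup>+x. ennreal (gauss_density v (f x) * exp (- s * (infdist (f x) V)\<^sup>2)) \<partial>lborel)"
    by (rule nn_integral_lborel_orthogonal[OF _ f, symmetric]) measurable
  also have "\<dots> \<le> (\<integral>\<^sup>+x. ennreal (gauss_density v x * exp (- s * (\<Sum>b\<in>C. (x \<bullet> b)\<^sup>2))) \<partial>lborel)"
    using v s le
    by (intro nn_integral_mono ennreal_leI mult_mono)
      (auto simp: gauss_density_def orthogonal_transformation_norm[OF f] intro!: mult_left_mono)
  also have "\<dots> = ennreal ((1 / sqrt (1 + s * v)) ^ (DIM('a) - dim V))"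
    using nn_integral_gauss_density_coords[OF v s, of C] by (simp add: cC) (simp add: C_def)
  finally show ?thesis .
qed

section \<open>Inverse moments of the distance to a subspace\<close>

text \<open>Turns an inverse moment into an integral of Laplace transforms. At \<open>d = 0\<close>
  both sides are infinite: a half-line of finite measure \<open>r\<close> would contain an interval
  of length \<open>r + 1\<close>.\<close>

lemma inverse_ennreal_eq_nn_integral_exp:
  fixes d :: real
  assumes d: "d \<ge> 0"
  shows "inverse (ennreal d) = (\<integral>\<^sup>+s. ennreal (exp (- s * d)) * indicator {0..} s \<partial>lborel)"
proof (cases "d = 0")
  case True
  have "emeasure lborel {0::real..} = \<infinity>"
  proof (rule ccontr)
    assume "emeasure lborel {0::real..} \<noteq> \<infinity>"
    then obtain r where r: "r \<ge> 0" "emeasure lborel {0::real..} = ennreal r"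
      by (cases "emeasure lborel {0::real..}") auto
    have "emeasure lborel {0..r + 1} \<le> emeasure lborel {0::real..}"
      by (rule emeasure_mono) auto
    then show False using r by simp
  qed
  then show ?thesis using True by simp
next
  case False
  have "(\<integral>\<^sup>+s. ennreal (exp (- s * d)) * indicator {0..} s \<partial>lborel) = ennreal (0 - (- exp (- 0 * d) / d))"
  proof (rule nn_integral_FTC_atLeast)
    show "((\<lambda>s. - exp (- s * d) / d) has_real_derivative exp (- x * d)) (at x)" for x
      using False by (auto intro!: derivative_eq_intros)
    have "((\<lambda>s. - exp (- (s * d)) / d) \<longlongrightarrow> - 0 / d) at_top"
      using d False
      by (intro tendsto_divide tendsto_minus tendsto_const filterlim_compose[OF exp_at_bot]
          filterlim_compose[OF filterlim_uminus_at_bot_at_top]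
          filterlim_at_top_mult_tendsto_pos[OF tendsto_const] filterlim_ident) auto
    then show "((\<lambda>s. - exp (- s * d) / d) \<longlongrightarrow> 0) at_top" by simp
  qed auto
  then show ?thesis using d False by (simp add: inverse_ennreal inverse_eq_divide)
qed

text \<open>The antiderivative is \<open>- (1 / (1 + s * v)) ^ j / (v * real j)\<close>, which tends
  to 0. For \<open>j = 0\<close> the integral would diverge.\<close>

lemma nn_integral_inverse_power:
  fixes v :: real
  assumes v: "v > 0" and j: "j > 0"
  shows "(\<integral>\<^sup>+s. ennreal ((1 / (1 + s * v)) ^ Suc j) * indicator {0..} s \<partial>lborel) = ennreal (1 / (v * real j))"
proof -
  have "(\<integral>\<^sup>+s. ennreal ((1 / (1 + s * v)) ^ Suc j) * indicator {0..} s \<partial>lborel)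
      = ennreal (0 - (- ((1 / (1 + 0 * v)) ^ j) / (v * real j)))"
  proof (rule nn_integral_FTC_atLeast)
    fix x :: real assume x: "0 \<le> x"
    then have p: "1 + x * v > 0" using v by (simp add: add_pos_nonneg)
    obtain i where i: "j = Suc i" using j by (cases j) auto
    show "((\<lambda>s. - ((1 / (1 + s * v)) ^ j) / (v * real j)) has_real_derivative (1 / (1 + x * v)) ^ Suc j) (at x)"
      unfolding i
      by (rule derivative_eq_intros refl | (use p v in \<open>simp; fail\<close>))+
    show "0 \<le> (1 / (1 + x * v)) ^ Suc j" using p by simp
  next
    have *: "((\<lambda>s. 1 / (1 + s * v)) \<longlongrightarrow> 0) at_top"
      using v
      by (intro tendsto_divide_0[OF tendsto_const] filterlim_at_top_imp_at_infinity
          filterlim_tendsto_add_at_top[OF tendsto_const]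
          filterlim_at_top_mult_tendsto_pos[OF tendsto_const] filterlim_ident) auto
    have "((\<lambda>s. - ((1 / (1 + s * v)) ^ j) / (v * real j)) \<longlongrightarrow> - (0 ^ j) / (v * real j)) at_top"
      using v j by (intro tendsto_divide tendsto_minus tendsto_power * tendsto_const) auto
    then show "((\<lambda>s. - ((1 / (1 + s * v)) ^ j) / (v * real j)) \<longlongrightarrow> 0) at_top" using j by (simp add: zero_power)
  qed measurable
  then show ?thesis by simp
qed

text \<open>Write the inverse as an integral over \<open>s\<close>, swap the integrals, and apply
  the Laplace transform bound for each \<open>s\<close>.\<close>

lemma nn_integral_gauss_density_inverse_infdist:
  fixes V :: "'a::euclidean_space set"
  assumes v: "v > 0" and V: "subspace V" and j: "j > 0" and dim: "dim V + 2 * Suc j \<le> DIM('a)"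
  shows "(\<integral>\<^sup>+x. ennreal (gauss_density v x) * inverse (ennreal ((infdist x V)\<^sup>2)) \<partial>lborel)
           \<le> ennreal (1 / (v * real j))"
proof -
  have [measurable]: "(\<lambda>x. infdist x V) \<in> borel_measurable borel"
    by (intro borel_measurable_continuous_onI continuous_intros)
  have "(\<integral>\<^sup>+x. ennreal (gauss_density v x) * inverse (ennreal ((infdist x V)\<^sup>2)) \<partial>lborel)
     = (\<integral>\<^sup>+x. (\<integral>\<^sup>+s. ennreal (gauss_density v x * exp (- s * (infdist x V)\<^sup>2)) * indicator {0..} s \<partial>lborel) \<partial>lborel)"
    using v by (simp add: inverse_ennreal_eq_nn_integral_exp nn_integral_cmult[symmetric]
        ennreal_mult mult.assoc)
  also have "\<dots> = (\<integral>\<^sup>+s. (\<integral>\<^sup>+x. ennreal (gauss_density v x * exp (- s * (infdist x V)\<^sup>2)) * indicator {0..} s \<partial>lborel) \<partial>lborel)"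
    by (rule lborel_pair.Fubini') measurable
  also have "\<dots> = (\<integral>\<^sup>+s. (\<integral>\<^sup>+x. ennreal (gauss_density v x * exp (- s * (infdist x V)\<^sup>2)) \<partial>lborel) * indicator {0..} s \<partial>lborel)"
    by (simp add: nn_integral_multc)
  also have "\<dots> \<le> (\<integral>\<^sup>+s. ennreal ((1 / (1 + s * v)) ^ Suc j) * indicator {0..} s \<partial>lborel)"
  proof (rule nn_integral_mono)
    fix s :: real
    have "(\<integral>\<^sup>+x. ennreal (gauss_density v x * exp (- s * (infdist x V)\<^sup>2)) \<partial>lborel)
        \<le> ennreal ((1 / (1 + s * v)) ^ Suc j)" if s: "s \<ge> 0"
    proof -
      have p: "1 + s * v \<ge> 1" using v s by simp
      \<comment> \<open>The base is at most 1, so the codimension may be lowered to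
        \<open>2 * Suc j\<close>; the even exponent removes the square root.\<close>
      have "(1 / sqrt (1 + s * v)) ^ (DIM('a) - dim V) \<le> (1 / sqrt (1 + s * v)) ^ (2 * Suc j)"
        using dim p by (intro power_decreasing) auto
      also have "\<dots> = (1 / (1 + s * v)) ^ Suc j"
        unfolding power_mult using p by (simp add: power_divide)
      finally show ?thesis
        using nn_integral_gauss_density_infdist[OF v s V] by (meson ennreal_leI order_trans)
    qed
    then show "(\<integral>\<^sup>+x. ennreal (gauss_density v x * exp (- s * (infdist x V)\<^sup>2)) \<partial>lborel) * indicator {0..} s
        \<le> ennreal ((1 / (1 + s * v)) ^ Suc j) * indicator {0..} s"
      by (cases "s \<ge> 0") auto
  qed
  also have "\<dots> = ennreal (1 / (v * real j))" by (rule nn_integral_inverse_power[OF v j])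
  finally show ?thesis .
qed

section \<open>Integration over one row of a matrix\<close>

lemma measurable_axis [measurable]:
  "(axis i :: 'a::euclidean_space \<Rightarrow> 'a ^ 'l) \<in> borel_measurable borel"
proof (rule borel_measurable_continuous_onI)
  have "continuous_on UNIV (\<lambda>y. if k = i then y else 0 :: 'a)" for k :: 'l
    by (cases "k = i") simp_all
  then show "continuous_on UNIV (axis i :: 'a \<Rightarrow> 'a ^ 'l)"
    unfolding axis_def[abs_def] by (intro continuous_on_vec_lambda)
qed

lemma measurable_vec_nth [measurable]:
  "(\<lambda>A :: 'a::euclidean_space ^ 'l. A $ i) \<in> borel_measurable borel"
  by (intro borel_measurable_continuous_onI continuous_intros)

text \<open>Fubini for one row, obtained by averaging over translates of that row with weight \<open>\<psi>\<close>, so that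
  the matrix space need not be split as a product: \<open>A + axis i (y - A $ i)\<close> is \<open>A\<close> with row \<open>i\<close>
  replaced by \<open>y\<close>.\<close>
lemma nn_integral_lborel_row:
  fixes F :: "'a::euclidean_space ^ 'l \<Rightarrow> ennreal" and \<psi> :: "'a \<Rightarrow> ennreal"
  assumes [measurable]: "F \<in> borel_measurable borel" "\<psi> \<in> borel_measurable borel"
    and even: "\<And>y. \<psi> (- y) = \<psi> y" and one: "(\<integral>\<^sup>+y. \<psi> y \<partial>lborel) = 1"
  shows "(\<integral>\<^sup>+A. F A \<partial>lborel)
           = (\<integral>\<^sup>+A. \<psi> (A $ i) * (\<integral>\<^sup>+y. F (A + axis i (y - A $ i)) \<partial>lborel) \<partial>lborel)"
proof -
  have "(\<integral>\<^sup>+A. F A \<partial>lborel) = (\<integral>\<^sup>+A. F A * (\<integral>\<^sup>+y. \<psi> (y + (- (A $ i))) \<partial>lborel) \<partial>lborel)"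
    by (subst nn_integral_lborel_translate) (simp_all add: one)
  also have "\<dots> = (\<integral>\<^sup>+A. (\<integral>\<^sup>+y. F A * \<psi> (A $ i - y) \<partial>lborel) \<partial>lborel)"
    using even[of "_ - _"] by (simp add: nn_integral_cmult)
  also have "\<dots> = (\<integral>\<^sup>+y. (\<integral>\<^sup>+A. F A * \<psi> (A $ i - y) \<partial>lborel) \<partial>lborel)"
    by (rule lborel_pair.Fubini') measurable
  also have "\<dots> = (\<integral>\<^sup>+y. (\<integral>\<^sup>+A. F (A + axis i y) * \<psi> (A $ i) \<partial>lborel) \<partial>lborel)"
  proof (rule nn_integral_cong)
    fix y :: 'a
    show "(\<integral>\<^sup>+A. F A * \<psi> (A $ i - y) \<partial>lborel) = (\<integral>\<^sup>+A. F (A + axis i y) * \<psi> (A $ i) \<partial>lborel)"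
      using nn_integral_lborel_translate[of "\<lambda>A. F A * \<psi> (A $ i - y)" "axis i y"]
      by simp
  qed
  also have "\<dots> = (\<integral>\<^sup>+A. (\<integral>\<^sup>+y. F (A + axis i y) * \<psi> (A $ i) \<partial>lborel) \<partial>lborel)"
    by (rule lborel_pair.Fubini') measurable
  also have "\<dots> = (\<integral>\<^sup>+A. \<psi> (A $ i) * (\<integral>\<^sup>+y. F (A + axis i (y - A $ i)) \<partial>lborel) \<partial>lborel)"
  proof (rule nn_integral_cong)
    fix A :: "'a ^ 'l"
    have "(\<integral>\<^sup>+y. F (A + axis i (y - A $ i)) \<partial>lborel) = (\<integral>\<^sup>+y. F (A + axis i y) \<partial>lborel)"
      using nn_integral_lborel_translate[of "\<lambda>y. F (A + axis i y)" "- (A $ i)"] by simp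
    then show "(\<integral>\<^sup>+y. F (A + axis i y) * \<psi> (A $ i) \<partial>lborel)
        = \<psi> (A $ i) * (\<integral>\<^sup>+y. F (A + axis i (y - A $ i)) \<partial>lborel)"
      by (simp add: nn_integral_multc) (simp add: mult.commute)
  qed
  finally show ?thesis .
qed

text \<open>A bound on the mean over row \<open>i\<close>, uniform in the other rows, bounds the
  full mean: the density splits into that of row \<open>i\<close> and a factor \<open>g\<close> that
  does not see this row.\<close>

lemma nn_integral_gauss_density_row_le:
  fixes f :: "'a::euclidean_space ^ 'l \<Rightarrow> ennreal"
  assumes v: "v > 0" and [measurable]: "f \<in> borel_measurable borel"
    and K: "\<And>A. (\<integral>\<^sup>+y. ennreal (gauss_density v y) * f (A + axis i (y - A $ i)) \<partial>lborel) \<le> K"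
  shows "(\<integral>\<^sup>+A. ennreal (gauss_density v A) * f A \<partial>lborel) \<le> K"
proof -
  define g where "g A = ennreal (\<Prod>k\<in>UNIV - {i}. gauss_density v (A $ k))" for A :: "'a ^ 'l"
  have split: "ennreal (gauss_density v A) = ennreal (gauss_density v (A $ i)) * g A" for A :: "'a ^ 'l"
    unfolding gauss_density_vec[symmetric] g_def using v
    by (subst prod.remove[of _ i]) (simp_all add: ennreal_mult prod_nonneg)
  have g: "g (A + axis i y) = g A" for A y
    unfolding g_def by (intro arg_cong[where f = ennreal] prod.cong) (auto simp: axis_def)
  \<comment> \<open>Taking the Gaussian density of the row itself as the weight
    \<open>\<psi>\<close> lets it recombine with \<open>g\<close> into the full density.\<close>
  have "(\<integral>\<^sup>+A. ennreal (gauss_density v A) * f A \<partial>lborel)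
      = (\<integral>\<^sup>+A. ennreal (gauss_density v (A $ i))
          * (\<integral>\<^sup>+y. ennreal (gauss_density v (A + axis i (y - A $ i))) * f (A + axis i (y - A $ i)) \<partial>lborel) \<partial>lborel)"
    using v by (intro nn_integral_lborel_row) (auto simp: nn_integral_gauss_density)
  also have "\<dots> = (\<integral>\<^sup>+A. ennreal (gauss_density v A)
          * (\<integral>\<^sup>+y. ennreal (gauss_density v y) * f (A + axis i (y - A $ i)) \<partial>lborel) \<partial>lborel)"
  proof (rule nn_integral_cong)
    fix A :: "'a ^ 'l"
    have "(\<integral>\<^sup>+y. ennreal (gauss_density v (A + axis i (y - A $ i))) * f (A + axis i (y - A $ i)) \<partial>lborel)
        = (\<integral>\<^sup>+y. g A * (ennreal (gauss_density v y) * f (A + axis i (y - A $ i))) \<partial>lborel)"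
      by (simp add: split[of "_ + _"] g mult_ac)
    also have "\<dots> = g A * (\<integral>\<^sup>+y. ennreal (gauss_density v y) * f (A + axis i (y - A $ i)) \<partial>lborel)"
      by (simp add: nn_integral_cmult)
    finally show "ennreal (gauss_density v (A $ i))
          * (\<integral>\<^sup>+y. ennreal (gauss_density v (A + axis i (y - A $ i))) * f (A + axis i (y - A $ i)) \<partial>lborel)
        = ennreal (gauss_density v A)
          * (\<integral>\<^sup>+y. ennreal (gauss_density v y) * f (A + axis i (y - A $ i)) \<partial>lborel)"
      by (simp add: split[of A] mult_ac)
  qed
  also have "\<dots> \<le> (\<integral>\<^sup>+A. ennreal (gauss_density v (A :: 'a ^ 'l)) * K \<partial>lborel)"
    by (intro nn_integral_mono mult_left_mono K) simp
  also have "\<dots> = K"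
    using v by (simp add: nn_integral_multc nn_integral_gauss_density)
  finally show ?thesis .
qed

text \<open>Each coordinate of \<open>f x\<close> is the inner product of \<open>x\<close> with a
  vector \<open>adjoint f c\<close>, whose second moment is known. The resulting sum is the squared
  Hilbert-Schmidt norm, which agrees for \<open>f\<close> and its adjoint.\<close>

lemma nn_integral_gauss_density_linear:
  fixes f :: "'a::euclidean_space \<Rightarrow> 'b::euclidean_space"
  assumes v: "v > 0" and f: "linear f"
  shows "(\<integral>\<^sup>+x. ennreal (gauss_density v x * (norm (f x))\<^sup>2) \<partial>lborel)
           = ennreal (v / 2 * (\<Sum>b\<in>Basis. (norm (f b))\<^sup>2))"
proof -
  have adj: "x \<bullet> adjoint f y = f x \<bullet> y" for x y by (rule adjoint_works[OF f])
  have "(\<integral>\<^sup>+x. ennreal (gauss_density v x * (norm (f x))\<^sup>2) \<partial>lborel)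
      = (\<integral>\<^sup>+x. (\<Sum>c\<in>Basis. ennreal (gauss_density v x * (x \<bullet> adjoint f c)\<^sup>2)) \<partial>lborel)"
    using v by (simp add: adj norm_power2_eq_sum_Basis[of "f _"] sum_distrib_left sum_ennreal)
  also have "\<dots> = (\<Sum>c\<in>Basis. ennreal (v / 2 * (norm (adjoint f c))\<^sup>2))"
    using v by (subst nn_integral_sum) (simp_all add: nn_integral_gauss_density_inner)
  also have "\<dots> = ennreal (v / 2 * (\<Sum>c\<in>Basis. (norm (adjoint f c))\<^sup>2))"
    using v by (simp add: sum_ennreal sum_distrib_left)
  also have "(\<Sum>c\<in>Basis. (norm (adjoint f c))\<^sup>2) = (\<Sum>c\<in>Basis. \<Sum>b\<in>Basis. (f b \<bullet> c)\<^sup>2)"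
    by (simp add: norm_power2_eq_sum_Basis[of "adjoint f _"] inner_commute[of "adjoint f _"] adj)
  also have "\<dots> = (\<Sum>b\<in>Basis. (norm (f b))\<^sup>2)"
    by (subst sum.swap) (simp add: norm_power2_eq_sum_Basis[of "f _"])
  finally show ?thesis .
qed

section \<open>Complex Gaussian vectors and the pseudo-inverse\<close>

lemma cgauss_density_eq: "v > 0 \<Longrightarrow> cgauss_density v z = gauss_density v z"
  by (simp add: cgauss_density_def gauss_density_def)

lemma cgauss_vector_eq: "v > 0 \<Longrightarrow> cgauss_vector v = density lborel (\<lambda>x. ennreal (gauss_density v x))"
  by (simp add: cgauss_vector_def cgauss_density_eq gauss_density_vec)

lemma cgauss_matrix_eq: "v > 0 \<Longrightarrow> cgauss_matrix v = density lborel (\<lambda>A. ennreal (gauss_density v A))"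
  by (simp add: cgauss_matrix_def cgauss_density_eq gauss_density_vec)

lemma norm_smult_complex: "norm (c *s x) = cmod c * norm (x :: complex ^ 'n)"
  by (simp add: norm_vec_def L2_set_def norm_mult power_mult_distrib sum_distrib_left[symmetric]
      real_sqrt_mult)

lemma sum_Basis_complex_vec:
  fixes f :: "complex ^ 'l \<Rightarrow> real"
  shows "(\<Sum>b\<in>Basis. f b) = (\<Sum>i\<in>UNIV. f (axis i 1) + f (axis i \<i>))"
proof -
  have "(\<Sum>b\<in>Basis. f b) = (\<Sum>i\<in>UNIV. \<Sum>b\<in>(\<lambda>u. axis i u) ` (Basis :: complex set). f b)"
    unfolding Basis_vec_def
    by (subst sum.UNION_disjoint[symmetric])
      (auto simp: axis_eq_axis Basis_complex_def intro!: sum.cong)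
  also have "\<dots> = (\<Sum>i\<in>UNIV. f (axis i 1) + f (axis i \<i>))"
    by (intro sum.cong refl) (simp add: Basis_complex_def axis_eq_axis)
  finally show ?thesis .
qed

lemma matrix_vector_mult_axis: "(M :: complex ^ 'l ^ 'n) *v axis i u = u *s column i M"
  by (simp add: vec_eq_iff matrix_vector_mult_def axis_def column_def if_distrib[of "\<lambda>t. _ * t"]
      mult.commute cong: if_cong)

lemma linear_matrix_vector_mult_complex: "linear (\<lambda>x. (M :: complex ^ 'l ^ 'n) *v x)"
  by (rule linearI)
    (simp_all add: vec_eq_iff matrix_vector_mult_def ring_distribs sum.distrib scaleR_sum_right)

lemma nn_integral_cgauss_vector_matrix_mult:
  fixes M :: "complex ^ 'l ^ 'n"
  assumes v: "v > 0"
  shows "(\<integral>\<^sup>+x. ennreal ((norm (M *v x))\<^sup>2) \<partial>cgauss_vector v)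
           = ennreal (v * (\<Sum>i\<in>UNIV. (norm (column i M))\<^sup>2))"
proof -
  have lin: "linear (\<lambda>x. M *v x)" by (rule linear_matrix_vector_mult_complex)
  have [measurable]: "(\<lambda>x. M *v x) \<in> borel_measurable borel"
    using lin by (intro borel_measurable_continuous_onI linear_continuous_on)
      (simp add: linear_conv_bounded_linear[symmetric])
  have "(\<integral>\<^sup>+x. ennreal ((norm (M *v x))\<^sup>2) \<partial>cgauss_vector v)
      = (\<integral>\<^sup>+x. ennreal (gauss_density v x * (norm (M *v x))\<^sup>2) \<partial>lborel)"
    using v by (simp add: cgauss_vector_eq nn_integral_density ennreal_mult)
  \<comment> \<open>The real basis vectors \<open>axis i 1\<close> and \<open>axis i \<i>\<close>
    both yield the norm of column \<open>i\<close>; this factor 2 cancels the half in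
    \<open>v / 2\<close>.\<close>
  also have "\<dots> = ennreal (v / 2 * (\<Sum>i\<in>UNIV. 2 * (norm (column i M))\<^sup>2))"
    using v by (simp add: nn_integral_gauss_density_linear[OF _ lin] sum_Basis_complex_vec
        matrix_vector_mult_axis norm_smult_complex)
  also have "\<dots> = ennreal (v * (\<Sum>i\<in>UNIV. (norm (column i M))\<^sup>2))"
    by (simp add: sum_distrib_left[symmetric])
  finally show ?thesis .
qed

section \<open>Distance of a row to the span of the other rows\<close>

text \<open>The complex span is given as the range of a linear parametrisation, so that the distance
  becomes an infimum over coefficient vectors.\<close>

definition other_rows_span :: "'l \<Rightarrow> complex ^ 'n ^ 'l \<Rightarrow> (complex ^ 'n) set" where
  "other_rows_span i A = range (\<lambda>c :: complex ^ 'l. \<Sum>k\<in>UNIV - {i}. c $ k *s A $ k)"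

lemma subspace_other_rows_span:
  fixes A :: "complex ^ 'n ^ 'l"
  shows "subspace (other_rows_span i A)"
proof -
  have "linear (\<lambda>c :: complex ^ 'l. \<Sum>k\<in>UNIV - {i}. c $ k *s A $ k)"
    by (rule linearI)
      (simp_all add: vec_eq_iff vector_scalar_mult_def distrib_right sum.distrib scaleR_sum_right)
  then show ?thesis
    unfolding other_rows_span_def by (rule linear_subspace_image[OF _ subspace_UNIV])
qed

text \<open>Over the reals, every row other than \<open>i\<close> contributes two directions, itself
  and its multiple by \<open>\<i>\<close>.\<close>

lemma dim_other_rows_span:
  fixes A :: "complex ^ 'n ^ 'l"
  shows "dim (other_rows_span i A) \<le> 2 * (CARD('l) - 1)"
proof -
  define S where "S = (\<lambda>k. A $ k) ` (UNIV - {i}) \<union> (\<lambda>k. \<i> *s A $ k) ` (UNIV - {i})"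
  have "c *s A $ k \<in> span S" if "k \<noteq> i" for c k
  proof -
    have "c *s A $ k = Re c *\<^sub>R (A $ k) + Im c *\<^sub>R (\<i> *s A $ k)"
      by (simp add: vec_eq_iff complex_eq_iff algebra_simps)
    moreover have "A $ k \<in> S" "\<i> *s A $ k \<in> S" using that by (auto simp: S_def)
    ultimately show ?thesis by (metis span_add span_base span_scale)
  qed
  then have "other_rows_span i A \<subseteq> span S"
    by (auto simp: other_rows_span_def intro!: span_sum)
  moreover have "finite S" by (simp add: S_def)
  ultimately have "dim (other_rows_span i A) \<le> card S" by (rule dim_le_card)
  also have "\<dots> \<le> card ((\<lambda>k. A $ k) ` (UNIV - {i})) + card ((\<lambda>k. \<i> *s A $ k) ` (UNIV - {i}))"
    unfolding S_def by (rule card_Un_le)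
  also have "\<dots> \<le> card (UNIV - {i}) + card (UNIV - {i})"
    by (intro add_mono card_image_le) auto
  also have "\<dots> = 2 * (CARD('l) - 1)" by simp
  finally show ?thesis .
qed

definition row_dist :: "'l \<Rightarrow> complex ^ 'n ^ 'l \<Rightarrow> real" where
  "row_dist i A = infdist (A $ i) (other_rows_span i A)"

lemma row_dist_update: "row_dist i (A + axis i (y - A $ i)) = infdist y (other_rows_span i A)"
proof -
  have "other_rows_span i (A + axis i (y - A $ i)) = other_rows_span i A"
    unfolding other_rows_span_def
    by (intro arg_cong[where f = range] ext sum.cong) (auto simp: axis_def)
  then show ?thesis by (simp add: row_dist_def)
qed

text \<open>For fixed coefficients the distance is continuous in the matrix, so a strict sublevel
  set of the infimum is a union of open sets. Openness makes the uncountable union harmless.\<close>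

lemma measurable_row_dist [measurable]:
  "(row_dist i :: complex ^ 'n ^ 'l \<Rightarrow> real) \<in> borel_measurable borel"
proof (rule borel_measurableI_less)
  fix a :: real
  define D where "D c A = dist (A $ i) (\<Sum>k\<in>UNIV - {i}. c $ k *s A $ k)"
    for c :: "complex ^ 'l" and A :: "complex ^ 'n ^ 'l"
  have rD: "row_dist i A = (INF c. D c A)" for A :: "complex ^ 'n ^ 'l"
    by (simp add: row_dist_def infdist_def other_rows_span_def image_image D_def)
  have "row_dist i A < a \<longleftrightarrow> (\<exists>c. D c A < a)" for A
    unfolding rD by (subst cINF_less_iff) (auto simp: D_def intro!: bdd_belowI2[of _ 0])
  then have eq: "{A :: complex ^ 'n ^ 'l \<in> space borel. row_dist i A < a} = (\<Union>c. {A. D c A < a})" by auto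
  have "open {A. D c A < a}" for c
  proof -
    have "continuous_on UNIV (\<lambda>A :: complex ^ 'n ^ 'l. c $ k *s A $ k)" for k
      unfolding vector_scalar_mult_def by (intro continuous_intros)
    then have "continuous_on UNIV (D c)"
      unfolding D_def[abs_def] by (intro continuous_intros)
    then show ?thesis by (intro open_Collect_less continuous_intros)
  qed
  then have "open (\<Union>c. {A. D c A < a})" by (intro open_UN ballI)
  then show "{A :: complex ^ 'n ^ 'l \<in> space borel. row_dist i A < a} \<in> sets borel"
    unfolding eq by (rule borel_open)
qed

lemma nn_integral_cgauss_matrix_inverse_row_dist:
  assumes v: "v > 0" and card: "CARD('l) < CARD('n)"
  shows "(\<integral>\<^sup>+A. inverse (ennreal ((row_dist i A)\<^sup>2)) \<partial>(cgauss_matrix v :: (complex ^ 'n ^ 'l) measure))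
           \<le> ennreal (1 / (v * (real CARD('n) - real CARD('l))))"
proof -
  have "(\<integral>\<^sup>+A. inverse (ennreal ((row_dist i A)\<^sup>2)) \<partial>(cgauss_matrix v :: (complex ^ 'n ^ 'l) measure))
      = (\<integral>\<^sup>+A. ennreal (gauss_density v (A :: complex ^ 'n ^ 'l)) * inverse (ennreal ((row_dist i A)\<^sup>2)) \<partial>lborel)"
    using v by (simp add: cgauss_matrix_eq nn_integral_density)
  also have "\<dots> \<le> ennreal (1 / (v * real (CARD('n) - CARD('l))))"
  proof (rule nn_integral_gauss_density_row_le[OF v, where i = i])
    fix A :: "complex ^ 'n ^ 'l"
    \<comment> \<open>With \<open>j = N - L\<close> this is the required codimension: at least
      \<open>2 * N - 2 * (L - 1) = 2 * Suc j\<close> real dimensions remain. Positivity of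
      \<open>l\<close> guards the natural subtraction \<open>l - 1\<close>.\<close>
    have "d + 2 * Suc (n - l) \<le> 2 * n" if "d \<le> 2 * (l - 1)" "0 < l" "l < n" for d l n :: nat
      using that by presburger
    from this[OF dim_other_rows_span zero_less_card_finite card]
    have "dim (other_rows_span i A) + 2 * Suc (CARD('n) - CARD('l)) \<le> DIM(complex ^ 'n)"
      by (simp add: mult.commute)
    then show "(\<integral>\<^sup>+y. ennreal (gauss_density v y) * inverse (ennreal ((row_dist i (A + axis i (y - A $ i)))\<^sup>2)) \<partial>lborel)
        \<le> ennreal (1 / (v * real (CARD('n) - CARD('l))))"
      unfolding row_dist_update using card
      by (intro nn_integral_gauss_density_inverse_infdist[OF v subspace_other_rows_span]) auto
  qed measurable
  finally show ?thesis using card by (simp add: of_nat_diff)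
qed

section \<open>Columns of the pseudo-inverse against row distances\<close>

lemma cnj_vec_inner: "(\<Sum>j\<in>UNIV. cnj (p $ j) * p $ j) = complex_of_real ((norm p)\<^sup>2)"
  for p :: "complex ^ 'n"
  by (simp add: norm_vec_def L2_set_def sum_nonneg complex_norm_square mult.commute del: of_real_power)

text \<open>The conjugate of the column \<open>p\<close> is a combination of the rows of
  \<open>G\<close> in which row \<open>i\<close> has coefficient \<open>(norm p)\<^sup>2\<close>.
  Dividing by that coefficient shows row \<open>i\<close> to differ from a combination of the others
  by a vector of norm \<open>1 / norm p\<close>.\<close>

lemma norm_column_pinv_le:
  fixes G :: "complex ^ 'n ^ 'l"
  assumes inv: "invertible (G ** conj_transpose G)"
  shows "norm (column i (pinv G)) * row_dist i G \<le> 1"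
proof -
  define X where "X = matrix_inv (G ** conj_transpose G)"
  define p where "p = column i (pinv G)"
  define q where "q = (norm p)\<^sup>2"
  have "(G ** conj_transpose G) ** X = mat 1"
    using someI_ex[OF inv[unfolded invertible_def]] unfolding X_def matrix_inv_def by blast
  then have GP: "G ** pinv G = mat 1" by (simp add: pinv_def X_def matrix_mul_assoc)
  have p: "p $ j = (\<Sum>k\<in>UNIV. cnj (G $ k $ j) * X $ k $ i)" for j
    by (simp add: p_def column_def pinv_def X_def matrix_matrix_mult_def conj_transpose_def)
  have Gp: "(\<Sum>j\<in>UNIV. G $ k $ j * p $ j) = (if k = i then 1 else 0)" for k
    using arg_cong[OF GP, of "\<lambda>M. M $ k $ i"] by (simp add: matrix_matrix_mult_def p_def column_def mat_def)
  \<comment> \<open>Expand one factor of the squared norm of \<open>p\<close> through the rows of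
    \<open>G\<close>; as \<open>G\<close> maps \<open>p\<close> to the \<open>i\<close>-th unit
    vector, only the diagonal entry of \<open>X\<close> survives.\<close>
  have "complex_of_real q = (\<Sum>j\<in>UNIV. cnj (p $ j) * p $ j)"
    by (simp only: q_def cnj_vec_inner)
  also have "\<dots> = (\<Sum>j\<in>UNIV. \<Sum>k\<in>UNIV. cnj (X $ k $ i) * (G $ k $ j * p $ j))"
    by (intro sum.cong refl) (subst p, simp add: sum_distrib_right, simp add: mult_ac)
  also have "\<dots> = (\<Sum>k\<in>UNIV. cnj (X $ k $ i) * (\<Sum>j\<in>UNIV. G $ k $ j * p $ j))"
    by (subst sum.swap) (simp add: sum_distrib_left)
  also have "\<dots> = cnj (X $ i $ i)"
    by (simp add: Gp if_distrib[of "\<lambda>t. _ * t"] cong: if_cong)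
  finally have Xii: "cnj (X $ i $ i) = complex_of_real q" by simp
  show ?thesis
  proof (cases "p = 0")
    case False
    then have q: "q > 0" by (simp add: q_def)
    define c :: "complex ^ 'l" where "c = (\<chi> k. - cnj (X $ k $ i) / of_real q)"
    have cp: "G $ i $ j - (\<Sum>k\<in>UNIV - {i}. c $ k * G $ k $ j) = cnj (p $ j) / of_real q" for j
    proof -
      have "cnj (p $ j) = (\<Sum>k\<in>UNIV. G $ k $ j * cnj (X $ k $ i))" by (simp add: p)
      also have "\<dots> = G $ i $ j * of_real q + (\<Sum>k\<in>UNIV - {i}. G $ k $ j * cnj (X $ k $ i))"
        by (subst sum.remove[of _ i]) (simp_all add: Xii)
      finally show ?thesis
        using q by (simp add: c_def sum_divide_distrib sum_negf add_divide_distrib mult.commute)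
    qed
    have "norm (G $ i - (\<Sum>k\<in>UNIV - {i}. c $ k *s G $ k)) = norm (\<chi> j. cnj (p $ j) / of_real q)"
      by (rule arg_cong[where f = norm]) (simp add: vec_eq_iff cp)
    also have "\<dots> = norm p / q"
      using q by (simp add: norm_vec_def norm_mult norm_inverse L2_set_right_distrib divide_inverse mult.commute)
    also have "\<dots> = 1 / norm p" by (simp add: q_def power2_eq_square)
    finally have "row_dist i G \<le> 1 / norm p"
      unfolding row_dist_def other_rows_span_def
      by (intro infdist_le2[where a = "\<Sum>k\<in>UNIV - {i}. c $ k *s G $ k"]) (auto simp: dist_norm)
    then show ?thesis using False by (simp add: p_def[symmetric] field_simps)
  qed (simp add: p_def[symmetric])
qed

text \<open>A kernel vector \<open>x\<close> of the Gram matrix gives a linear relation between the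
  rows, with the conjugates of its entries as coefficients. Any row with nonzero coefficient lies in
  the span of the others.\<close>

lemma row_dist_zero_if_singular:
  fixes G :: "complex ^ 'n ^ 'l"
  assumes "\<not> invertible (G ** conj_transpose G)"
  obtains i where "row_dist i G = 0"
proof -
  obtain x where x: "(G ** conj_transpose G) *v x = 0" "x \<noteq> 0"
    using assms unfolding invertible_left_inverse matrix_left_invertible_ker by blast
  define p where "p = conj_transpose G *v x"
  have Gp: "G *v p = 0" using x(1) by (simp add: p_def matrix_vector_mul_assoc)
  \<comment> \<open>The squared norm of \<open>p\<close> is the pairing of \<open>x\<close> with
    \<open>G *v p\<close>, which vanishes.\<close>
  have "complex_of_real ((norm p)\<^sup>2) = (\<Sum>j\<in>UNIV. cnj (p $ j) * p $ j)"
    by (rule cnj_vec_inner[symmetric])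
  also have "\<dots> = (\<Sum>j\<in>UNIV. \<Sum>k\<in>UNIV. cnj (x $ k) * (G $ k $ j * p $ j))"
    by (intro sum.cong refl)
      (subst p_def, simp add: matrix_vector_mult_def conj_transpose_def sum_distrib_right,
        simp add: mult_ac)
  also have "\<dots> = (\<Sum>k\<in>UNIV. cnj (x $ k) * (G *v p) $ k)"
    by (subst sum.swap) (simp add: sum_distrib_left matrix_vector_mult_def)
  also have "\<dots> = 0" by (simp add: Gp)
  finally have "p = 0" by simp
  have 0: "(\<Sum>k\<in>UNIV. G $ k $ j * cnj (x $ k)) = 0" for j
  proof -
    have "(\<Sum>k\<in>UNIV. G $ k $ j * cnj (x $ k)) = cnj (p $ j)"
      by (simp add: p_def matrix_vector_mult_def conj_transpose_def)
    then show ?thesis using \<open>p = 0\<close> by simp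
  qed
  obtain i where i: "x $ i \<noteq> 0" using x(2) by (auto simp: vec_eq_iff)
  define c :: "complex ^ 'l" where "c = (\<chi> k. - cnj (x $ k) / cnj (x $ i))"
  have "G $ i $ j = (\<Sum>k\<in>UNIV - {i}. c $ k * G $ k $ j)" for j
  proof -
    have "G $ i $ j * cnj (x $ i) + (\<Sum>k\<in>UNIV - {i}. G $ k $ j * cnj (x $ k)) = 0"
      using 0[of j] by (subst (asm) sum.remove[of _ i]) simp_all
    then have "G $ i $ j = - (\<Sum>k\<in>UNIV - {i}. G $ k $ j * cnj (x $ k)) / cnj (x $ i)"
      using i by (simp add: field_simps eq_neg_iff_add_eq_0)
    then show ?thesis by (simp add: c_def sum_divide_distrib sum_negf mult.commute)
  qed
  then have "G $ i = (\<Sum>k\<in>UNIV - {i}. c $ k *s G $ k)" by (simp add: vec_eq_iff)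
  then have "G $ i \<in> other_rows_span i G" by (auto simp: other_rows_span_def)
  then have "row_dist i G = 0" by (simp add: row_dist_def)
  then show thesis by (rule that)
qed

text \<open>For singular \<open>G G\<^sup>H\<close>, where \<open>pinv G\<close> is a junk value, the right-hand side is infinite.\<close>
lemma sum_norm_column_pinv_le:
  fixes G :: "complex ^ 'n ^ 'l"
  shows "ennreal (\<Sum>i\<in>UNIV. (norm (column i (pinv G)))\<^sup>2) \<le> (\<Sum>i\<in>UNIV. inverse (ennreal ((row_dist i G)\<^sup>2)))"
proof (cases "invertible (G ** conj_transpose G)")
  case True
  have "ennreal ((norm (column i (pinv G)))\<^sup>2) \<le> inverse (ennreal ((row_dist i G)\<^sup>2))" for i
  proof (cases "row_dist i G = 0")
    case False
    then have d: "row_dist i G > 0" using infdist_nonneg[of "G $ i"] by (simp add: row_dist_def less_le)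
    then have "norm (column i (pinv G)) \<le> 1 / row_dist i G"
      using norm_column_pinv_le[OF True, of i] by (simp add: field_simps)
    then have "(norm (column i (pinv G)))\<^sup>2 \<le> (1 / row_dist i G)\<^sup>2" by (intro power_mono) auto
    then show ?thesis
      using d by (simp add: inverse_ennreal power_divide inverse_eq_divide)
  qed simp
  then show ?thesis by (simp add: sum_ennreal[symmetric] sum_mono del: sum_ennreal)
next
  case False
  then obtain i where "row_dist i G = 0" by (rule row_dist_zero_if_singular)
  then have "(\<Sum>i\<in>UNIV. inverse (ennreal ((row_dist i G)\<^sup>2))) = top"
    by (subst sum.remove[of _ i]) simp_all
  then show ?thesis by (simp only: top_greatest)
qed

section \<open>The bound on the mean norm\<close>

theorem theorem4:
  fixes \<sigma>\<^sub>1 \<sigma>\<^sub>2 :: real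
  assumes "CARD('l) + 1 < CARD('n)"
    and "\<sigma>\<^sub>1 > 0" and "\<sigma>\<^sub>2 > 0"
  shows "(\<integral>\<^sup>+ G. (\<integral>\<^sup>+ x. ennreal (norm (pinv G *v x)) \<partial>(cgauss_vector (\<sigma>\<^sub>2\<^sup>2) :: (complex ^ 'l) measure))
            \<partial>(cgauss_matrix (\<sigma>\<^sub>1\<^sup>2) :: (complex ^ 'n ^ 'l) measure))
         \<le> ennreal (sqrt (real CARD('l) / (real CARD('n) - real CARD('l) - 1)) * (\<sigma>\<^sub>2 / \<sigma>\<^sub>1))"
proof -
  let ?x = "cgauss_vector (\<sigma>\<^sub>2\<^sup>2) :: (complex ^ 'l) measure"
  let ?G = "cgauss_matrix (\<sigma>\<^sub>1\<^sup>2) :: (complex ^ 'n ^ 'l) measure"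
  define L where "L = real CARD('l)"
  define N where "N = real CARD('n)"
  define C where "C = sqrt (L / (N - L - 1)) * (\<sigma>\<^sub>2 / \<sigma>\<^sub>1)"
  have NL: "N - L - 1 > 0" "L > 0" using assms(1) by (simp_all add: L_def N_def)
  have C: "C > 0" using NL assms by (simp add: C_def)
  have v: "\<sigma>\<^sub>1\<^sup>2 > 0" "\<sigma>\<^sub>2\<^sup>2 > 0" using assms by simp_all
  \<comment> \<open>Total mass 1 is what lets the constant term \<open>C / 2\<close> pass unchanged
    through both integrals.\<close>
  have x1: "emeasure ?x (space ?x) = 1"
    using v by (simp add: cgauss_vector_eq emeasure_density nn_integral_gauss_density)
  have G1: "emeasure ?G (space ?G) = 1"
    using v by (simp add: cgauss_matrix_eq emeasure_density nn_integral_gauss_density)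
  have [measurable_cong]: "sets ?x = sets borel" "sets ?G = sets borel"
    using v by (simp_all add: cgauss_vector_eq cgauss_matrix_eq)
  have inner: "(\<integral>\<^sup>+ x. ennreal (norm (pinv G *v x)) \<partial>?x)
      \<le> ennreal (\<sigma>\<^sub>2\<^sup>2 / (2 * C)) * (\<Sum>i\<in>UNIV. inverse (ennreal ((row_dist i G)\<^sup>2))) + ennreal (C / 2)"
    for G :: "complex ^ 'n ^ 'l"
  proof -
    have [measurable]: "(\<lambda>x. pinv G *v x) \<in> borel_measurable borel"
      by (intro borel_measurable_continuous_onI linear_continuous_on)
        (simp add: linear_conv_bounded_linear[symmetric] linear_matrix_vector_mult_complex)
    \<comment> \<open>AM-GM with the target value \<open>C\<close> as weight replaces Jensen's inequality.\<close>
    have amgm: "t \<le> t\<^sup>2 / (2 * C) + C / 2" for t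
      using C zero_le_power2[of "t - C"] by (simp add: field_simps power2_eq_square)
    have "(\<integral>\<^sup>+ x. ennreal (norm (pinv G *v x)) \<partial>?x)
        \<le> (\<integral>\<^sup>+ x. ennreal (1 / (2 * C)) * ennreal ((norm (pinv G *v x))\<^sup>2) + ennreal (C / 2) \<partial>?x)"
    proof (rule nn_integral_mono)
      fix x
      show "ennreal (norm (pinv G *v x))
          \<le> ennreal (1 / (2 * C)) * ennreal ((norm (pinv G *v x))\<^sup>2) + ennreal (C / 2)"
        using C amgm[of "norm (pinv G *v x)"] by (simp add: ennreal_mult[symmetric] ennreal_plus[symmetric] del: ennreal_plus)
    qed
    also have "\<dots> = ennreal (1 / (2 * C)) * (\<integral>\<^sup>+ x. ennreal ((norm (pinv G *v x))\<^sup>2) \<partial>?x) + ennreal (C / 2)"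
      by (simp add: nn_integral_add nn_integral_cmult x1)
    also have "\<dots> = ennreal (\<sigma>\<^sub>2\<^sup>2 / (2 * C)) * ennreal (\<Sum>i\<in>UNIV. (norm (column i (pinv G)))\<^sup>2) + ennreal (C / 2)"
      using C v by (simp add: nn_integral_cgauss_vector_matrix_mult ennreal_mult'[symmetric])
    also have "\<dots> \<le> ennreal (\<sigma>\<^sub>2\<^sup>2 / (2 * C)) * (\<Sum>i\<in>UNIV. inverse (ennreal ((row_dist i G)\<^sup>2))) + ennreal (C / 2)"
      by (intro add_right_mono mult_left_mono sum_norm_column_pinv_le) simp
    finally show ?thesis .
  qed
  \<comment> \<open>Monotonicity asks no measurability in \<open>G\<close> of the inner integral;
    the majorant is measurable through \<open>measurable_row_dist\<close>, so linearity applies to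
    it.\<close>
  have "(\<integral>\<^sup>+ G. (\<integral>\<^sup>+ x. ennreal (norm (pinv G *v x)) \<partial>?x) \<partial>?G)
      \<le> (\<integral>\<^sup>+ G. ennreal (\<sigma>\<^sub>2\<^sup>2 / (2 * C)) * (\<Sum>i\<in>UNIV. inverse (ennreal ((row_dist i G)\<^sup>2))) + ennreal (C / 2) \<partial>?G)"
    by (intro nn_integral_mono inner)
  also have "\<dots> = ennreal (\<sigma>\<^sub>2\<^sup>2 / (2 * C)) * (\<Sum>i\<in>UNIV. \<integral>\<^sup>+ G. inverse (ennreal ((row_dist i G)\<^sup>2)) \<partial>?G) + ennreal (C / 2)"
    by (simp add: nn_integral_add nn_integral_cmult nn_integral_sum G1)
  also have "\<dots> \<le> ennreal (\<sigma>\<^sub>2\<^sup>2 / (2 * C)) * (\<Sum>i\<in>(UNIV :: 'l set). ennreal (1 / (\<sigma>\<^sub>1\<^sup>2 * (N - L)))) + ennreal (C / 2)"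
    unfolding N_def L_def using assms(1) v
    by (intro add_right_mono mult_left_mono sum_mono nn_integral_cgauss_matrix_inverse_row_dist) auto
  also have "\<dots> = ennreal (\<sigma>\<^sub>2\<^sup>2 / (2 * C) * (L / (\<sigma>\<^sub>1\<^sup>2 * (N - L))) + C / 2)"
  proof -
    have "(\<Sum>i\<in>(UNIV :: 'l set). ennreal (1 / (\<sigma>\<^sub>1\<^sup>2 * (N - L)))) = ennreal (L / (\<sigma>\<^sub>1\<^sup>2 * (N - L)))"
      using NL by (subst sum_ennreal) (simp_all add: L_def)
    then show ?thesis
      using C NL by (simp add: ennreal_mult[symmetric] ennreal_plus[symmetric] del: ennreal_plus sum_constant)
  qed
  also have "\<dots> \<le> ennreal C"
  proof (rule ennreal_leI)
    have "\<sigma>\<^sub>2\<^sup>2 * (L / (\<sigma>\<^sub>1\<^sup>2 * (N - L))) = L / (N - L) * (\<sigma>\<^sub>2 / \<sigma>\<^sub>1)\<^sup>2"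
      by (simp add: power_divide mult_ac)
    \<comment> \<open>The second moment comes out with denominator \<open>N - L\<close>; shrinking
      it to \<open>N - L - 1\<close> gives \<open>C\<^sup>2\<close>, so the quadratic term is at
      most \<open>C / 2\<close>.\<close>
    also have "\<dots> \<le> L / (N - L - 1) * (\<sigma>\<^sub>2 / \<sigma>\<^sub>1)\<^sup>2"
      using NL by (intro mult_right_mono divide_left_mono) auto
    also have "\<dots> = C\<^sup>2" unfolding C_def power_mult_distrib using NL by simp
    finally have "\<sigma>\<^sub>2\<^sup>2 * (L / (\<sigma>\<^sub>1\<^sup>2 * (N - L))) / (2 * C) \<le> C\<^sup>2 / (2 * C)"
      using C by (intro divide_right_mono) auto
    moreover have "C\<^sup>2 / (2 * C) = C / 2" using C by (simp add: power2_eq_square)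
    ultimately show "\<sigma>\<^sub>2\<^sup>2 / (2 * C) * (L / (\<sigma>\<^sub>1\<^sup>2 * (N - L))) + C / 2 \<le> C"
      by (simp only: times_divide_eq_left)
  qed
  finally show ?thesis by (simp add: C_def L_def N_def)
qed

end
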